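(* Let $(X,G,\mathrm{int})$ be a Generalized Interval System, let $S\colon\mathbf{G}\to\mathbf{Sets}$ be the simply transitive group action of $G$ on $X$ that it determines, and let $\mathbf{C}$ be the category associated with $(X,G,\mathrm{int})$. Then $\mathbf{C}$ is the category of elements $\int_{\mathbf{G}}S$; that is, the assignment $x\mapsto(\bullet,x)$ on objects and $(x,y)\mapsto(x,\mathrm{int}(x,y),y)$ on morphisms is an isomorphism of categories $\mathbf{C}\to\int_{\mathbf{G}}S$.
   Context: A Generalized Interval System (GIS) is a triple $(X,G,\mathrm{int})$ where $X$ is a set, $G$ is a group with operation $*$, and $\mathrm{int}\colon X\times X\to G$ is a function such that (1) for all $x,y,z\in X$, $\mathrm{int}(y,z)*\mathrm{int}(x,y)=\mathrm{int}(x,z)$; and (2) for all $x\in X$ and $g\in G$ there exists a unique $y\in X$ such that $\mathrm{int}(x,y)=g$. $\mathbf{G}$ denotes the group $G$ regarded as a category with a single object $\bullet$, whose morphisms are the elements of $G$ with composition $h\circ g=h*g$. A GIS determines a simply transitive left action of $G$ on $X$, i.e. a functor $S\colon\mathbf{G}\to\mathbf{Sets}$ with $S(\bullet)=X$, where for $g\in G$ and $x\in X$, $S(g)(x)$ is the unique $y\in X$ with $\mathrm{int}(x,y)=g$. The category $\mathbf{C}$ associated with $(X,G,\mathrm{int})$ has $X$ as its set of objects and exactly one morphism $(x,y)\colon x\to y$ for each pair $(x,y)\in X\times X$, with composition $(y,z)\circ(x,y)=(x,z)$. For a functor $S\colon\mathbf{D}\to\mathbf{Sets}$, the category of elements $\int_{\mathbf{D}}S$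 has as objects the pairs $(D,x)$ with $D$ an object of $\mathbf{D}$ and $x\in S(D)$, and as morphisms from $(D,x)$ to $(E,y)$ the triples $(x,f,y)$ with $f\colon D\to E$ a morphism of $\mathbf{D}$ such that $y=S(f)(x)$; composition is induced by that of $\mathbf{D}$. *)

theory Defs
  imports "HOL-Algebra.Group"
begin

text \<open>Small categories on explicit carriers. As in HOL-Algebra, the operations are
  meaningful on the carriers only; \<open>Comp C g f\<close> is \<open>g \<circ> f\<close>.\<close>

record ('o, 'a) cat =
  Obj :: "'o set"
  Arr :: "'a set"
  Dom :: "'a \<Rightarrow> 'o"
  Cod :: "'a \<Rightarrow> 'o"
  Ident :: "'o \<Rightarrow> 'a"
  Comp :: "'a \<Rightarrow> 'a \<Rightarrow> 'a"

locale category =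
  fixes C :: "('o, 'a) cat"
  assumes Dom_closed: "f \<in> Arr C \<Longrightarrow> Dom C f \<in> Obj C"
    and Cod_closed: "f \<in> Arr C \<Longrightarrow> Cod C f \<in> Obj C"
    and Ident_closed: "a \<in> Obj C \<Longrightarrow> Ident C a \<in> Arr C"
    and Dom_Ident: "a \<in> Obj C \<Longrightarrow> Dom C (Ident C a) = a"
    and Cod_Ident: "a \<in> Obj C \<Longrightarrow> Cod C (Ident C a) = a"
    and Comp_closed: "\<lbrakk>g \<in> Arr C; f \<in> Arr C; Dom C g = Cod C f\<rbrakk> \<Longrightarrow> Comp C g f \<in> Arr C"
    and Dom_Comp: "\<lbrakk>g \<in> Arr C; f \<in> Arr C; Dom C g = Cod C f\<rbrakk> \<Longrightarrow> Dom C (Comp C g f) = Dom C f"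
    and Cod_Comp: "\<lbrakk>g \<in> Arr C; f \<in> Arr C; Dom C g = Cod C f\<rbrakk> \<Longrightarrow> Cod C (Comp C g f) = Cod C g"
    and Comp_Ident: "f \<in> Arr C \<Longrightarrow> Comp C f (Ident C (Dom C f)) = f"
    and Ident_Comp: "f \<in> Arr C \<Longrightarrow> Comp C (Ident C (Cod C f)) f = f"
    and Comp_assoc: "\<lbrakk>h \<in> Arr C; g \<in> Arr C; f \<in> Arr C; Dom C h = Cod C g; Dom C g = Cod C f\<rbrakk>
          \<Longrightarrow> Comp C (Comp C h g) f = Comp C h (Comp C g f)"

record ('o, 'a, 'p, 'b) fctr =
  on_obj :: "'o \<Rightarrow> 'p"
  on_arr :: "'a \<Rightarrow> 'b"

locale cat_functor = C: category C + D: category D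
  for C :: "('o, 'a) cat" and D :: "('p, 'b) cat" +
  fixes F :: "('o, 'a, 'p, 'b) fctr"
  assumes on_obj_closed: "a \<in> Obj C \<Longrightarrow> on_obj F a \<in> Obj D"
    and on_arr_closed: "f \<in> Arr C \<Longrightarrow> on_arr F f \<in> Arr D"
    and Dom_on_arr: "f \<in> Arr C \<Longrightarrow> Dom D (on_arr F f) = on_obj F (Dom C f)"
    and Cod_on_arr: "f \<in> Arr C \<Longrightarrow> Cod D (on_arr F f) = on_obj F (Cod C f)"
    and on_arr_Ident: "a \<in> Obj C \<Longrightarrow> on_arr F (Ident C a) = Ident D (on_obj F a)"
    and on_arr_Comp: "\<lbrakk>g \<in> Arr C; f \<in> Arr C; Dom C g = Cod C f\<rbrakk>
          \<Longrightarrow> on_arr F (Comp C g f) = Comp D (on_arr F g) (on_arr F f)"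

definition cat_isomorphism ::
    "('o, 'a) cat \<Rightarrow> ('p, 'b) cat \<Rightarrow> ('o, 'a, 'p, 'b) fctr \<Rightarrow> bool" where
  "cat_isomorphism C D F \<longleftrightarrow> cat_functor C D F \<and>
     (\<exists>K. cat_functor D C K \<and>
        (\<forall>a \<in> Obj C. on_obj K (on_obj F a) = a) \<and>
        (\<forall>f \<in> Arr C. on_arr K (on_arr F f) = f) \<and>
        (\<forall>b \<in> Obj D. on_obj F (on_obj K b) = b) \<and>
        (\<forall>g \<in> Arr D. on_arr F (on_arr K g) = g))"

text \<open>The category of all subsets of the type \<open>'x\<close>. An arrow \<open>A \<rightarrow> B\<close> is a triple \<open>(A, f, B)\<close>;
  taking \<open>f\<close> extensional on \<open>A\<close> makes equality of arrows equality of maps.\<close>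

type_synonym 'x set_arr = "'x set \<times> ('x \<Rightarrow> 'x) \<times> 'x set"

definition Sets :: "('x set, 'x set_arr) cat" where
  "Sets = \<lparr>Obj = UNIV,
           Arr = {(A, f, B). f \<in> A \<rightarrow>\<^sub>E B},
           Dom = (\<lambda>(A, f, B). A),
           Cod = (\<lambda>(A, f, B). B),
           Ident = (\<lambda>A. (A, \<lambda>x\<in>A. x, A)),
           Comp = (\<lambda>(B, g, C) (A, f, B'). (A, compose A g f, C))\<rparr>"

definition set_fun :: "'x set_arr \<Rightarrow> 'x \<Rightarrow> 'x" where
  "set_fun = (\<lambda>(A, f, B). f)"

definition elements_cat ::
    "('o, 'a) cat \<Rightarrow> ('o, 'a, 'x set, 'x set_arr) fctr \<Rightarrow> ('o \<times> 'x, 'x \<times> 'a \<times> 'x) cat" where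
  "elements_cat D S =
     \<lparr>Obj = {(d, x). d \<in> Obj D \<and> x \<in> on_obj S d},
      Arr = {(x, f, y). f \<in> Arr D \<and> x \<in> on_obj S (Dom D f) \<and> y \<in> on_obj S (Cod D f) \<and>
                        y = set_fun (on_arr S f) x},
      Dom = (\<lambda>(x, f, y). (Dom D f, x)),
      Cod = (\<lambda>(x, f, y). (Cod D f, y)),
      Ident = (\<lambda>(d, x). (x, Ident D d, x)),
      Comp = (\<lambda>(y, g, z) (x, f, y'). (x, Comp D g f, z))\<rparr>"

definition group_cat :: "('g, 'm) monoid_scheme \<Rightarrow> (unit, 'g) cat" where
  "group_cat G =
     \<lparr>Obj = {()},
      Arr = carrier G,
      Dom = (\<lambda>_. ()),
      Cod = (\<lambda>_. ()),
      Ident = (\<lambda>_. \<one>\<^bsub>G\<^esub>),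
      Comp = (\<lambda>h g. h \<otimes>\<^bsub>G\<^esub> g)\<rparr>"

locale GIS = group G
  for X :: "'x set" and G :: "('g, 'm) monoid_scheme" (structure)
    and intv :: "'x \<Rightarrow> 'x \<Rightarrow> 'g" +
  assumes intv_closed: "\<lbrakk>x \<in> X; y \<in> X\<rbrakk> \<Longrightarrow> intv x y \<in> carrier G"
    and intv_mult: "\<lbrakk>x \<in> X; y \<in> X; z \<in> X\<rbrakk> \<Longrightarrow> intv y z \<otimes> intv x y = intv x z"
    and intv_unique: "\<lbrakk>x \<in> X; g \<in> carrier G\<rbrakk> \<Longrightarrow> \<exists>!y. y \<in> X \<and> intv x y = g"

definition GIS_action ::
    "'x set \<Rightarrow> ('x \<Rightarrow> 'x \<Rightarrow> 'g) \<Rightarrow> (unit, 'g, 'x set, 'x set_arr) fctr" where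
  "GIS_action X intv =
     \<lparr>on_obj = (\<lambda>_. X),
      on_arr = (\<lambda>g. (X, \<lambda>x\<in>X. THE y. y \<in> X \<and> intv x y = g, X))\<rparr>"

text \<open>The category associated with a GIS depends on the underlying set only.\<close>

definition GIS_cat :: "'x set \<Rightarrow> ('x, 'x \<times> 'x) cat" where
  "GIS_cat X =
     \<lparr>Obj = X,
      Arr = X \<times> X,
      Dom = fst,
      Cod = snd,
      Ident = (\<lambda>x. (x, x)),
      Comp = (\<lambda>(y, z) (x, y'). (x, z))\<rparr>"

lemma category_Sets: "category (Sets :: ('x set, 'x set_arr) cat)"
  by unfold_locales
    (auto simp: Sets_def compose_def PiE_iff extensional_def restrict_def fun_eq_iff)

lemma (in group) category_group_cat: "category (group_cat G)"
  by unfold_locales (auto simp: group_cat_def m_assoc)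

context GIS
begin

lemma GIS_action_apply:
  assumes "x \<in> X" "g \<in> carrier G"
  shows "set_fun (on_arr (GIS_action X intv) g) x \<in> X"
    and "intv x (set_fun (on_arr (GIS_action X intv) g) x) = g"
  using theI'[OF intv_unique[OF assms]] assms(1)
  by (simp_all add: GIS_action_def set_fun_def)

lemma GIS_action_eqI:
  assumes "x \<in> X" "y \<in> X" "intv x y = g"
  shows "set_fun (on_arr (GIS_action X intv) g) x = y"
proof -
  have g: "g \<in> carrier G"
    using assms intv_closed by blast
  show ?thesis
    using the1_equality[OF intv_unique[OF assms(1) g]] assms
    by (simp add: GIS_action_def set_fun_def)
qed

lemma intv_self: "x \<in> X \<Longrightarrow> intv x x = \<one>"
  by (metis intv_mult intv_closed l_cancel_one)

lemma GIS_action_functor: "cat_functor (group_cat G) Sets (GIS_action X intv)"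
proof -
  let ?S = "GIS_action X intv"
  have arr: "on_arr ?S g = (X, \<lambda>x\<in>X. set_fun (on_arr ?S g) x, X)" for g
    by (auto simp: GIS_action_def set_fun_def)
  have one: "on_arr ?S \<one> = (X, \<lambda>x\<in>X. x, X)"
    by (subst arr) (simp add: GIS_action_eqI intv_self cong: restrict_cong)
  have mult: "on_arr ?S (h \<otimes> g) =
      (X, compose X (set_fun (on_arr ?S h)) (set_fun (on_arr ?S g)), X)"
    if "h \<in> carrier G" "g \<in> carrier G" for h g
  proof -
    have "set_fun (on_arr ?S (h \<otimes> g)) x = set_fun (on_arr ?S h) (set_fun (on_arr ?S g) x)"
      if x: "x \<in> X" for x
    proof -
      let ?y = "set_fun (on_arr ?S g) x"
      let ?z = "set_fun (on_arr ?S h) ?y"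
      have y: "?y \<in> X" "intv x ?y = g"
        using GIS_action_apply[of x g] x \<open>g \<in> carrier G\<close> by auto
      have z: "?z \<in> X" "intv ?y ?z = h"
        using GIS_action_apply[of ?y h] y \<open>h \<in> carrier G\<close> by auto
      show ?thesis
        using intv_mult[OF x y(1) z(1)] y z x by (intro GIS_action_eqI) auto
    qed
    then show ?thesis
      by (subst arr) (simp add: compose_def cong: restrict_cong)
  qed
  have closed: "on_arr ?S g \<in> Arr Sets" if "g \<in> carrier G" for g
    using GIS_action_apply(1)[OF _ that] by (subst arr) (auto simp: Sets_def)
  interpret C: category "group_cat G" by (rule category_group_cat)
  interpret D: category "Sets :: ('x set, 'x set_arr) cat" by (rule category_Sets)
  show ?thesis
  proof unfold_locales
    fix g f
    assume *: "g \<in> Arr (group_cat G)" "f \<in> Arr (group_cat G)"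
    have comp: "Comp Sets (on_arr ?S g) (on_arr ?S f) =
        (X, compose X (set_fun (on_arr ?S g)) (set_fun (on_arr ?S f)), X)"
      by (simp add: Sets_def GIS_action_def set_fun_def)
    show "on_arr ?S (Comp (group_cat G) g f) = Comp Sets (on_arr ?S g) (on_arr ?S f)"
      unfolding comp using * mult by (simp add: group_cat_def)
  qed (use closed one in \<open>auto simp: group_cat_def Sets_def GIS_action_def\<close>)
qed

lemma GIS_action_simply_transitive:
  assumes "x \<in> X" "y \<in> X"
  shows "\<exists>!g. g \<in> carrier G \<and> set_fun (on_arr (GIS_action X intv) g) x = y"
proof (rule ex1I)
  show "intv x y \<in> carrier G \<and> set_fun (on_arr (GIS_action X intv) (intv x y)) x = y"
    using assms by (simp add: intv_closed GIS_action_eqI)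
  show "g = intv x y"
    if "g \<in> carrier G \<and> set_fun (on_arr (GIS_action X intv) g) x = y" for g
    using GIS_action_apply(2)[of x g] assms(1) that by simp
qed

end

end

theory Submission
  imports Defs
begin

text \<open>Since S(g)(x) is the unique y with int(x,y) = g, the condition y = S(g)(x) means exactly
  g = int(x,y). Hence between two elements there is exactly one arrow, labelled by their interval
  (\<open>Arr_elements_GIS_action\<close>), just as in the category of the GIS. Labelling respects
  composition by the first GIS axiom and identities by \<open>intv_self\<close>; forgetting the
  label inverts it.\<close>

lemma category_GIS_cat: "category (GIS_cat X)"
  by unfold_locales (auto simp: GIS_cat_def)

text \<open>Functoriality of \<open>S\<close>, read pointwise, keeps the condition y = S(f)(x) true
  for identities and composites; the category laws are then those of \<open>D\<close>.\<close>

lemma category_elements_cat: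
  assumes "cat_functor D (Sets :: ('x set, 'x set_arr) cat) S"
  shows "category (elements_cat D S)"
proof -
  interpret S: cat_functor D "Sets :: ('x set, 'x set_arr) cat" S
    by (fact assms)
  have ident: "set_fun (on_arr S (Ident D d)) x = x" if "d \<in> Obj D" "x \<in> on_obj S d" for d x
    using that S.on_arr_Ident[OF that(1)] by (simp add: Sets_def set_fun_def)
  \<comment> \<open>\<open>compose\<close> is meaningful only on the domain stored in the triple
    \<open>on_arr S f\<close>; \<open>Dom_on_arr\<close> identifies that set with
    \<open>on_obj S (Dom D f)\<close>, which contains \<open>x\<close>.\<close>
  have comp: "set_fun (on_arr S (Comp D g f)) x = set_fun (on_arr S g) (set_fun (on_arr S f) x)"
    if "g \<in> Arr D" "f \<in> Arr D" "Dom D g = Cod D f" "x \<in> on_obj S (Dom D f)" for g f x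
    using that S.on_arr_Comp[OF that(1-3)] S.Dom_on_arr[OF that(2)]
    by (auto simp: Sets_def set_fun_def compose_def split: prod.splits)
  note closed = S.C.Dom_closed S.C.Cod_closed S.C.Ident_closed S.C.Comp_closed
  note ends = S.C.Dom_Ident S.C.Cod_Ident S.C.Dom_Comp S.C.Cod_Comp
  note laws = S.C.Comp_Ident S.C.Ident_Comp S.C.Comp_assoc
  show ?thesis
    by unfold_locales (auto simp: elements_cat_def ident comp closed ends laws)
qed

context GIS
begin

text \<open>\<open>GIS_action_apply\<close> forces the label of an arrow to be the interval of its
  ends, and \<open>GIS_action_eqI\<close> makes every pair so labelled an arrow.\<close>

lemma Arr_elements_GIS_action:
  "Arr (elements_cat (group_cat G) (GIS_action X intv)) = (\<lambda>(x, y). (x, intv x y, y)) ` (X \<times> X)"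
proof -
  have "(x, g, y) \<in> Arr (elements_cat (group_cat G) (GIS_action X intv)) \<longleftrightarrow>
      x \<in> X \<and> y \<in> X \<and> g = intv x y" for x g y
    using GIS_action_apply[of x g] GIS_action_eqI[of x y g] intv_closed[of x y]
    by (auto simp: elements_cat_def group_cat_def GIS_action_def)
  then show ?thesis
    by (auto simp: image_iff)
qed

lemma elements_GIS_action_simps:
  "Obj (elements_cat (group_cat G) (GIS_action X intv)) = {()} \<times> X"
  "Dom (elements_cat (group_cat G) (GIS_action X intv)) = (\<lambda>(x, g, y). ((), x))"
  "Cod (elements_cat (group_cat G) (GIS_action X intv)) = (\<lambda>(x, g, y). ((), y))"
  "Ident (elements_cat (group_cat G) (GIS_action X intv)) = (\<lambda>(d, x). (x, \<one>, x))"
  "Comp (elements_cat (group_cat G) (GIS_action X intv)) =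
     (\<lambda>(y, h, z) (x, g, y'). (x, h \<otimes> g, z))"
  by (auto simp: elements_cat_def group_cat_def GIS_action_def)

lemma cat_isomorphism_elements_GIS_action:
  "cat_isomorphism (GIS_cat X) (elements_cat (group_cat G) (GIS_action X intv))
     \<lparr>on_obj = (\<lambda>x. ((), x)), on_arr = (\<lambda>(x, y). (x, intv x y, y))\<rparr>"
  (is "cat_isomorphism ?C ?D ?F")
proof -
  \<comment> \<open>The inverse drops the label. It is functorial because arrows of
    \<open>?C\<close> are determined by their ends, and no information is lost because the label is
    \<open>intv x y\<close>.\<close>
  let ?K = "\<lparr>on_obj = snd, on_arr = (\<lambda>(x, g, y). (x, y))\<rparr>"
  interpret C: category ?C
    by (rule category_GIS_cat)
  interpret D: category ?D
    by (intro category_elements_cat GIS_action_functor)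
  note simps = GIS_cat_def Arr_elements_GIS_action elements_GIS_action_simps
  have "cat_functor ?C ?D ?F"
    by unfold_locales (auto simp: simps intv_self intv_mult)
  moreover have "cat_functor ?D ?C ?K"
    by unfold_locales (auto simp: simps)
  ultimately show ?thesis
    unfolding cat_isomorphism_def by (intro conjI exI[of _ ?K]) (auto simp: simps)
qed

end

theorem corollary1:
  fixes X :: "'x set" and G :: "('g, 'm) monoid_scheme" and intv :: "'x \<Rightarrow> 'x \<Rightarrow> 'g"
  assumes "GIS X G intv"
  shows "cat_isomorphism (GIS_cat X) (elements_cat (group_cat G) (GIS_action X intv))
           \<lparr>on_obj = (\<lambda>x. ((), x)), on_arr = (\<lambda>(x, y). (x, intv x y, y))\<rparr>"
  using assms by (rule GIS.cat_isomorphism_elements_GIS_action)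

end
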